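(* Let $E$ be a finite nonempty set of participants with normalized law invariant risk measures $\rho_i:\mathcal{X}\to\mathbb{R}$ and receivables $R_i$ ($i\in E$), let $P$ be the $m$-dimensional random payoff vector, and let $r_i(q)=\rho_i(-R_i-q^\top P)$ for $q\in\mathbb{R}^m$, $i\in E$. Let $((\mathbf{q}_i)_{i\in E},\mathbf{p})$ be a Radner equilibrium on $E$. (i) If $r_i$ is differentiable at $\mathbf{q}_i$ for some $i\in E$, then the equilibrium price $\mathbf{p}$ is unique, i.e. every Radner equilibrium on $E$ has price vector $\mathbf{p}$. (ii) For any $i\in E$, if $r_i$ is differentiable and strictly convex on $\mathbb{R}^m$, then the equilibrium position $\mathbf{q}_i$ is unique, i.e. in every Radner equilibrium on $E$ the position of participant $i$ is $\mathbf{q}_i$.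
   Context: Setting: $(\Omega,\mathcal{A},\mathbb{P})$ is a probability space; $\mathcal{X}$ is a linear subspace of the space $\mathcal{L}^1$ of integrable random variables (identified almost surely) containing the constants; $m\ge 1$; $P$ is a random vector in $\mathbb{R}^m$ and each $R_i$ is a real random variable, with $R_i$ and all components of $P$ in $\mathcal{X}$. A risk measure is a function $\rho:\mathcal{X}\to\mathbb{R}$ that is monotone ($X\le Y$ implies $\rho(X)\le\rho(Y)$), convex ($\rho(\lambda X+(1-\lambda)Y)\le\lambda\rho(X)+(1-\lambda)\rho(Y)$ for $0\le\lambda\le 1$) and translation invariant ($\rho(X-c)=\rho(X)-c$ for $c\in\mathbb{R}$). It is normalized if $\rho(0)=0$ and law invariant if $\rho(X)=\rho(Y)$ whenever $X$ and $Y$ have the same law. Radner equilibrium on $E$: a family $(\mathbf{q}_i)_{i\in E}$ in $\mathbb{R}^m$ and a vector $\mathbf{p}\in\mathbb{R}^m$ such that (optimality) for every $i\in E$ and every $q_i\in\mathbb{R}^m$, $\rho_i(-R_i+\mathbf{q}_i^\top(\mathbf{p}-P))\le\rho_i(-R_i+q_i^\top(\mathbf{p}-P))$, and (zero clearing) $\sum_{i\in E}\mathbf{q}_i=0$. *)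

theory Defs
  imports "HOL-Probability.Probability"
begin

(* A linear subspace of L^1 containing the constants.  Classes of a.s. equal random variables are
   represented by the set of all their representatives, hence the closure condition ae_closed. *)
locale risk_domain = prob_space M for M :: "'w measure" +
  fixes \<X> :: "('w \<Rightarrow> real) set"
  assumes integrable_mem: "X \<in> \<X> \<Longrightarrow> integrable M X"
    and const_mem: "(\<lambda>_. c) \<in> \<X>"
    and add_mem: "X \<in> \<X> \<Longrightarrow> Y \<in> \<X> \<Longrightarrow> (\<lambda>\<omega>. X \<omega> + Y \<omega>) \<in> \<X>"
    and scale_mem: "X \<in> \<X> \<Longrightarrow> (\<lambda>\<omega>. c * X \<omega>) \<in> \<X>"
    and ae_closed: "X \<in> \<X> \<Longrightarrow> Y \<in> borel_measurable M \<Longrightarrow> (AE \<omega> in M. X \<omega> = Y \<omega>) \<Longrightarrow> Y \<in> \<X>"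

(* The order is the a.s. order; monotonicity therefore forces \<rho> to respect a.s. equality. *)
definition risk_measure ::
    "'w measure \<Rightarrow> ('w \<Rightarrow> real) set \<Rightarrow> (('w \<Rightarrow> real) \<Rightarrow> real) \<Rightarrow> bool" where
  "risk_measure M \<X> \<rho> \<longleftrightarrow>
     (\<forall>X\<in>\<X>. \<forall>Y\<in>\<X>. (AE \<omega> in M. X \<omega> \<le> Y \<omega>) \<longrightarrow> \<rho> X \<le> \<rho> Y) \<and>
     (\<forall>X\<in>\<X>. \<forall>Y\<in>\<X>. \<forall>t\<in>{0..1}.
        \<rho> (\<lambda>\<omega>. t * X \<omega> + (1 - t) * Y \<omega>) \<le> t * \<rho> X + (1 - t) * \<rho> Y) \<and>
     (\<forall>X\<in>\<X>. \<forall>c. \<rho> (\<lambda>\<omega>. X \<omega> - c) = \<rho> X - c)"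

definition normalized :: "(('w \<Rightarrow> real) \<Rightarrow> real) \<Rightarrow> bool" where
  "normalized \<rho> \<longleftrightarrow> \<rho> (\<lambda>_. 0) = 0"

definition law_invariant ::
    "'w measure \<Rightarrow> ('w \<Rightarrow> real) set \<Rightarrow> (('w \<Rightarrow> real) \<Rightarrow> real) \<Rightarrow> bool" where
  "law_invariant M \<X> \<rho> \<longleftrightarrow>
     (\<forall>X\<in>\<X>. \<forall>Y\<in>\<X>. distr M borel X = distr M borel Y \<longrightarrow> \<rho> X = \<rho> Y)"

definition position_risk ::
    "(('w \<Rightarrow> real) \<Rightarrow> real) \<Rightarrow> ('w \<Rightarrow> real) \<Rightarrow> ('w \<Rightarrow> real ^ 'm) \<Rightarrow> real ^ 'm \<Rightarrow> real" where
  "position_risk \<rho> R P q = \<rho> (\<lambda>\<omega>. - R \<omega> - q \<bullet> P \<omega>)"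

definition radner_equilibrium ::
    "'i set \<Rightarrow> ('i \<Rightarrow> ('w \<Rightarrow> real) \<Rightarrow> real) \<Rightarrow> ('i \<Rightarrow> 'w \<Rightarrow> real) \<Rightarrow> ('w \<Rightarrow> real ^ 'm) \<Rightarrow>
      ('i \<Rightarrow> real ^ 'm) \<Rightarrow> real ^ 'm \<Rightarrow> bool" where
  "radner_equilibrium E \<rho> R P q p \<longleftrightarrow>
     (\<forall>i\<in>E. \<forall>x. \<rho> i (\<lambda>\<omega>. - R i \<omega> + q i \<bullet> (p - P \<omega>)) \<le> \<rho> i (\<lambda>\<omega>. - R i \<omega> + x \<bullet> (p - P \<omega>))) \<and>
     (\<Sum>i\<in>E. q i) = 0"

definition strictly_convex_on :: "'a::real_vector set \<Rightarrow> ('a \<Rightarrow> real) \<Rightarrow> bool" where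
  "strictly_convex_on S f \<longleftrightarrow> convex S \<and>
     (\<forall>x\<in>S. \<forall>y\<in>S. \<forall>t\<in>{0<..<1}. x \<noteq> y \<longrightarrow>
        f (t *\<^sub>R x + (1 - t) *\<^sub>R y) < t * f x + (1 - t) * f y)"

end

theory Submission
  imports Defs
begin

text \<open>By translation invariance, optimality of \<open>q i\<close> says that it minimizes \<open>r i x + x \<bullet> p\<close>
  over all \<open>x\<close>. For two equilibria, clearing makes the linear terms vanish after summation over the
  participants, so both allocations have the same total risk. Hence none of the individual
  optimality inequalities between them is strict, and each allocation is also optimal at the other
  price. Uniqueness of the gradient then yields the price, and uniqueness of the minimizer of a
  strictly convex function yields the position.\<close>

lemma (in risk_domain) sum_mem:
  assumes "finite A" "\<And>a. a \<in> A \<Longrightarrow> f a \<in> \<X>"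
  shows "(\<lambda>\<omega>. \<Sum>a\<in>A. f a \<omega>) \<in> \<X>"
  using assms
proof (induction A rule: finite_induct)
  case empty
  then show ?case using const_mem[of 0] by simp
next
  case (insert a A)
  then show ?case using add_mem[of "f a" "\<lambda>\<omega>. \<Sum>a\<in>A. f a \<omega>"] by simp
qed

text \<open>The inner product is a finite linear combination of the components of \<open>P\<close>,
  so it stays in the subspace.\<close>

lemma (in risk_domain) position_mem:
  fixes P :: "'w \<Rightarrow> real ^ 'm"
  assumes "R \<in> \<X>" "\<And>k. (\<lambda>\<omega>. P \<omega> $ k) \<in> \<X>"
  shows "(\<lambda>\<omega>. - R \<omega> - x \<bullet> P \<omega>) \<in> \<X>"
proof -
  have "(\<lambda>\<omega>. \<Sum>k\<in>UNIV. x $ k * P \<omega> $ k) \<in> \<X>"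
    using assms(2) by (intro sum_mem scale_mem) auto
  then have "(\<lambda>\<omega>. (-1) * R \<omega> + (-1) * (x \<bullet> P \<omega>)) \<in> \<X>"
    using assms(1) by (intro add_mem scale_mem) (simp_all add: inner_vec_def)
  then show ?thesis by simp
qed

text \<open>The payment \<open>x \<bullet> p\<close> is deterministic, so translation invariance
  moves it out of \<open>\<rho>\<close>.\<close>

lemma (in risk_domain) risk_of_trade:
  fixes P :: "'w \<Rightarrow> real ^ 'm"
  assumes "risk_measure M \<X> \<rho>" "R \<in> \<X>" "\<And>k. (\<lambda>\<omega>. P \<omega> $ k) \<in> \<X>"
  shows "\<rho> (\<lambda>\<omega>. - R \<omega> + x \<bullet> (p - P \<omega>)) = position_risk \<rho> R P x + x \<bullet> p"
proof -
  have "(\<lambda>\<omega>. - R \<omega> + x \<bullet> (p - P \<omega>)) = (\<lambda>\<omega>. (- R \<omega> - x \<bullet> P \<omega>) - (- (x \<bullet> p)))"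
    by (simp add: inner_diff_right algebra_simps)
  moreover have "\<rho> (\<lambda>\<omega>. (- R \<omega> - x \<bullet> P \<omega>) - (- (x \<bullet> p)))
      = \<rho> (\<lambda>\<omega>. - R \<omega> - x \<bullet> P \<omega>) - (- (x \<bullet> p))"
    using assms(1)[unfolded risk_measure_def, THEN conjunct2, THEN conjunct2]
    by (rule bspec[OF _ position_mem[OF assms(2,3)], THEN spec])
  ultimately show ?thesis by (simp add: position_risk_def)
qed

text \<open>This removes the probability: what remains is a family of minimization problems in
  finite dimension, coupled only by clearing.\<close>

lemma (in risk_domain) radner_equilibrium_iff:
  fixes P :: "'w \<Rightarrow> real ^ 'm"
  assumes "\<And>i. i \<in> E \<Longrightarrow> risk_measure M \<X> (\<rho> i)"
    and "\<And>i. i \<in> E \<Longrightarrow> R i \<in> \<X>"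
    and "\<And>k. (\<lambda>\<omega>. P \<omega> $ k) \<in> \<X>"
  shows "radner_equilibrium E \<rho> R P q p \<longleftrightarrow>
    (\<forall>i\<in>E. \<forall>x. position_risk (\<rho> i) (R i) P (q i) + q i \<bullet> p
      \<le> position_risk (\<rho> i) (R i) P x + x \<bullet> p) \<and> (\<Sum>i\<in>E. q i) = 0"
  unfolding radner_equilibrium_def using assms
  by (simp only: risk_of_trade cong: ball_cong)

lemma cleared_optimal_at_other_price:
  fixes q q' :: "'i \<Rightarrow> 'a::real_inner"
  assumes "finite E"
    and opt: "\<And>i x. i \<in> E \<Longrightarrow> r i (q i) + q i \<bullet> p \<le> r i x + x \<bullet> p"
    and opt': "\<And>i x. i \<in> E \<Longrightarrow> r i (q' i) + q' i \<bullet> p' \<le> r i x + x \<bullet> p'"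
    and clear: "(\<Sum>i\<in>E. q i) = 0" and clear': "(\<Sum>i\<in>E. q' i) = 0"
    and "i \<in> E"
  shows "r i (q' i) + q' i \<bullet> p \<le> r i x + x \<bullet> p"
proof -
  \<comment> \<open>Stated for every \<open>v\<close> because it is applied at both prices.\<close>
  have lin: "(\<Sum>i\<in>E. q i \<bullet> v) = 0" "(\<Sum>i\<in>E. q' i \<bullet> v) = 0" for v
    using clear clear' by (simp_all flip: inner_sum_left)
  \<comment> \<open>Each \<open>q' i\<close> is optimal at \<open>p'\<close>, in particular against
    the competitor \<open>q i\<close>. After summation the price terms are zero, so
    \<open>p'\<close> may be replaced by \<open>p\<close>.\<close>
  have "(\<Sum>i\<in>E. r i (q' i) + q' i \<bullet> p') \<le> (\<Sum>i\<in>E. r i (q i) + q i \<bullet> p')"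
    by (intro sum_mono opt')
  then have "(\<Sum>i\<in>E. r i (q' i) + q' i \<bullet> p) \<le> (\<Sum>i\<in>E. r i (q i) + q i \<bullet> p)"
    by (simp add: sum.distrib lin)
  \<comment> \<open>Optimality of \<open>q\<close> at \<open>p\<close> gives the reverse inequality
    in each term, so a single strict one would contradict the comparison of the sums.\<close>
  then have "r i (q' i) + q' i \<bullet> p \<le> r i (q i) + q i \<bullet> p"
    using sum_strict_mono_ex1[OF \<open>finite E\<close>, of "\<lambda>i. r i (q i) + q i \<bullet> p"
        "\<lambda>i. r i (q' i) + q' i \<bullet> p"] opt \<open>i \<in> E\<close> by (meson linorder_not_less)
  also have "\<dots> \<le> r i x + x \<bullet> p"
    using opt \<open>i \<in> E\<close> .
  finally show ?thesis .
qed

text \<open>Fermat's rule for the tilted function: its derivative at the minimizer vanishes, so the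
  gradient of \<open>f\<close> there is \<open>- p\<close>.\<close>

lemma has_derivative_at_tilted_min:
  fixes f :: "'a::real_inner \<Rightarrow> real"
  assumes "(f has_derivative f') (at y)" "\<And>x. f y + y \<bullet> p \<le> f x + x \<bullet> p"
  shows "f' = (\<lambda>v. - (v \<bullet> p))"
proof -
  have "((\<lambda>x. f x + x \<bullet> p) has_derivative (\<lambda>v. f' v + v \<bullet> p)) (at y)"
    using assms(1) by (auto intro!: derivative_eq_intros)
  then have "(\<lambda>v. f' v + v \<bullet> p) = (\<lambda>v. 0)"
    by (rule has_derivative_local_min) (simp add: assms(2))
  then show ?thesis
    by (metis eq_neg_iff_add_eq_0)
qed

text \<open>The same derivative is represented by both \<open>- p\<close> and \<open>- p'\<close>,
  and a vector is determined by its inner products.\<close>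

lemma differentiable_tilt_unique:
  fixes f :: "'a::real_inner \<Rightarrow> real"
  assumes "f differentiable (at y)"
    and "\<And>x. f y + y \<bullet> p \<le> f x + x \<bullet> p" "\<And>x. f y + y \<bullet> p' \<le> f x + x \<bullet> p'"
  shows "p' = p"
proof -
  obtain f' where "(f has_derivative f') (at y)"
    using assms(1) unfolding differentiable_def by blast
  then have "(\<lambda>v. - (v \<bullet> p')) = (\<lambda>v. - (v \<bullet> p))"
    using assms(2,3) by (metis has_derivative_at_tilted_min)
  then have "\<forall>v. v \<bullet> p' = v \<bullet> p"
    by (metis neg_equal_iff_equal)
  then show ?thesis
    using vector_eq_ldot by blast
qed

text \<open>A linear tilt preserves strict convexity, so the midpoint of two distinct minimizers
  would have a smaller value than both.\<close>

lemma strictly_convex_tilted_min_unique: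
  fixes f :: "'a::real_inner \<Rightarrow> real"
  assumes "strictly_convex_on UNIV f"
    and "\<And>x. f y + y \<bullet> p \<le> f x + x \<bullet> p" "\<And>x. f z + z \<bullet> p \<le> f x + x \<bullet> p"
  shows "z = y"
proof (rule ccontr)
  assume "z \<noteq> y"
  define t :: real where "t = 1/2"
  let ?m = "t *\<^sub>R z + (1 - t) *\<^sub>R y"
  have "t \<in> {0<..<1}" by (simp add: t_def)
  then have "f ?m < t * f z + (1 - t) * f y"
    using assms(1) \<open>z \<noteq> y\<close> unfolding strictly_convex_on_def by blast
  moreover have "?m \<bullet> p = t * (z \<bullet> p) + (1 - t) * (y \<bullet> p)"
    by (simp add: inner_add_left)
  \<comment> \<open>The average of the two minimality inequalities at the midpoint contradicts the
    strict one.\<close>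
  ultimately show False
    using assms(2)[of ?m] assms(3)[of ?m] by (simp add: t_def field_simps)
qed

theorem theorem2p3:
  fixes M :: "'w measure"
    and \<X> :: "('w \<Rightarrow> real) set"
    and E :: "'i set"
    and \<rho> :: "'i \<Rightarrow> ('w \<Rightarrow> real) \<Rightarrow> real"
    and R :: "'i \<Rightarrow> 'w \<Rightarrow> real"
    and P :: "'w \<Rightarrow> real ^ 'm"
    and r :: "'i \<Rightarrow> real ^ 'm \<Rightarrow> real"
    and q :: "'i \<Rightarrow> real ^ 'm"
    and p :: "real ^ 'm"
  assumes "risk_domain M \<X>"
    and "finite E" and "E \<noteq> {}"
    and "\<And>i. i \<in> E \<Longrightarrow> risk_measure M \<X> (\<rho> i)"
    and "\<And>i. i \<in> E \<Longrightarrow> normalized (\<rho> i)"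
    and "\<And>i. i \<in> E \<Longrightarrow> law_invariant M \<X> (\<rho> i)"
    and "\<And>i. i \<in> E \<Longrightarrow> R i \<in> \<X>"
    and "\<And>k. (\<lambda>\<omega>. P \<omega> $ k) \<in> \<X>"
    and "\<And>i. i \<in> E \<Longrightarrow> r i = position_risk (\<rho> i) (R i) P"
    and "radner_equilibrium E \<rho> R P q p"
  shows "((\<exists>i\<in>E. r i differentiable (at (q i))) \<longrightarrow>
            (\<forall>q' p'. radner_equilibrium E \<rho> R P q' p' \<longrightarrow> p' = p)) \<and>
         (\<forall>i\<in>E. (\<forall>x. r i differentiable (at x)) \<and> strictly_convex_on UNIV (r i) \<longrightarrow>
            (\<forall>q' p'. radner_equilibrium E \<rho> R P q' p' \<longrightarrow> q' i = q i))"
proof -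
  interpret risk_domain M \<X> by fact
  have eq: "(\<forall>i\<in>E. \<forall>x. r i (a i) + a i \<bullet> b \<le> r i x + x \<bullet> b) \<and> (\<Sum>i\<in>E. a i) = 0"
    if "radner_equilibrium E \<rho> R P a b" for a b
    using that radner_equilibrium_iff[of E \<rho> R P a b] assms(4,7-9) by simp
  have opt: "r i (q i) + q i \<bullet> p \<le> r i x + x \<bullet> p" if "i \<in> E" for i x
    using eq[OF assms(10)] that by blast
  \<comment> \<open>The exchange of prices is used in both directions, with the two equilibria
    swapped.\<close>
  have cross: "r i (q i) + q i \<bullet> p' \<le> r i x + x \<bullet> p'" "r i (q' i) + q' i \<bullet> p \<le> r i x + x \<bullet> p"
    if "radner_equilibrium E \<rho> R P q' p'" "i \<in> E" for q' p' i x
    using eq[OF assms(10)] eq[OF that(1)] that(2) \<open>finite E\<close>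
      cleared_optimal_at_other_price[of E r q p q' p' i x]
      cleared_optimal_at_other_price[of E r q' p' q p i x] by blast+
  \<comment> \<open>Here one position, \<open>q i\<close>, is optimal at both prices; for the
    positions below, \<open>q i\<close> and \<open>q' i\<close> are both optimal at the one price
    \<open>p\<close>.\<close>
  have "p' = p" if "i \<in> E" "r i differentiable (at (q i))" "radner_equilibrium E \<rho> R P q' p'"
    for i q' p'
    using that(2) opt[OF that(1)] cross(1)[OF that(3,1)] by (rule differentiable_tilt_unique)
  moreover have "q' i = q i"
    if "i \<in> E" "strictly_convex_on UNIV (r i)" "radner_equilibrium E \<rho> R P q' p'" for i q' p'
    using that(2) opt[OF that(1)] cross(2)[OF that(3,1)]
    by (rule strictly_convex_tilted_min_unique)
  ultimately show ?thesis by blast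
qed

end
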